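(* For every choice of data and prior $(\mathcal{D},p(\mathcal{M}))$, the Bayesian RL objective $$\mathcal{J}(\pi)=\mathbb{E}_{\mathcal{M}\sim p(\mathcal{M}\mid\mathcal{D})}\bigl[\mathcal{J}_{\mathcal{M}}(\pi)\bigr],\qquad \mathcal{J}_{\mathcal{M}}(\pi)=\mathbb{E}_{s_0,\pi}\Bigl[\sum_{t=0}^{T-1} r_{\mathcal{M}}(s_t,a_t)\Bigr],$$ has an optimal policy $\pi^*$ (a maximizer over all history-dependent policies) that is uncertainty-adaptive.
   Context: **MDPs.** There is a countable set $\mathcal{S}_0$ of prompts, a distribution of the initial state $s_0\in\mathcal{S}_0$, a finite nonempty action set $\mathcal{A}$ (reasoning steps, i.e. fixed-length blocks of tokens), and a finite horizon $T\ge 1$. A state is a prompt followed by a finite sequence of steps, so $\mathcal{S}=\bigcup_{t=0}^{T}\mathcal{S}_0\times\mathcal{A}^t$. Transitions are deterministic, by appending: $s_{t+1}=s_t+a_t$, meaning $(s_0,a_0,\dots,a_{t-1})+a_t=(s_0,a_0,\dots,a_{t-1},a_t)$. The MDPs $\mathcal{M}$ under consideration share these data and differ only in the reward function $r_{\mathcal{M}}:\mathcal{S}\times\mathcal{A}\to\mathbb{R}$; they range over a standard Borel space, $r_{\mathcal{M}}(s,a)$ is measurable in $\mathcal{M}$, and rewards are bounded by a common constant. **Posterior.** A prior $p(\mathcal{M})$ over MDPs and training data $\mathcal{D}$ define the posterior $p(\mathcal{M}\mid\mathcal{D})\propto p(\mathcal{M})\,p(\mathcal{D}\mid\mathcal{M})$.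 **Histories and policies.** A history is $h_t=(s_0,a_0,r_0,s_1,\dots,a_{t-1},r_{t-1},s_t)$, with $s_{i+1}=s_i+a_i$ and $r_i\in\mathbb{R}$; write $s(h_t)=s_t$. A policy $\pi$ assigns (measurably) to every history $h_t$, $0\le t\le T-1$, a distribution $\pi(\cdot\mid h_t)\in\Delta(\mathcal{A})$ (probability distributions on $\mathcal{A}$). When a policy is run in $\mathcal{M}$, the observed reward is $r_t=r_{\mathcal{M}}(s_t,a_t)$. **Belief and uncertainty-adaptive policies.** The belief is the posterior over MDPs $b(h_t)(\mathcal{M})=p(\mathcal{M}\mid h_t,\mathcal{D})$, i.e. (a fixed version of) the conditional law of $\mathcal{M}$ given $h_t$ when $\mathcal{M}\sim p(\mathcal{M}\mid\mathcal{D})$. A policy $\pi$ is uncertainty-adaptive if there is a measurable $\mu$, mapping pairs (state, probability distribution over MDPs) to $\Delta(\mathcal{A})$, such that $\pi(a_t\mid h_t)=\mu(a_t\mid s(h_t),b(h_t))$ for all $h_t$ and $a_t$. *)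

theory Defs
  imports "HOL-Probability.Probability"
begin

definition standard_borel :: "'m measure \<Rightarrow> bool" where
  "standard_borel M \<longleftrightarrow>
     (\<exists>X. completely_metrizable_space X \<and> separable_space X \<and>
          sets M = sets (sigma (topspace X) {U. openin X U}))"

text \<open>
  The set of prompts is the countable type \<open>'p\<close>, the finite nonempty action set is the
  finite type \<open>'a\<close>. A state is a prompt followed by the list of steps taken so far.
\<close>

type_synonym ('p, 'a) state = "'p \<times> 'a list"

definition states :: "nat \<Rightarrow> ('p, 'a) state set" where
  "states T = {s. length (snd s) \<le> T}"

definition append_step :: "('p, 'a) state \<Rightarrow> 'a \<Rightarrow> ('p, 'a) state" where
  "append_step s a = (fst s, snd s @ [a])"

text \<open>
  The history \<open>(s\<^sub>0, a\<^sub>0, r\<^sub>0, s\<^sub>1, \<dots>, a\<^sub>t\<^sub>-\<^sub>1, r\<^sub>t\<^sub>-\<^sub>1, s\<^sub>t)\<close> is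
  represented by \<open>([(s\<^sub>0, a\<^sub>0, r\<^sub>0), \<dots>, (s\<^sub>t\<^sub>-\<^sub>1, a\<^sub>t\<^sub>-\<^sub>1, r\<^sub>t\<^sub>-\<^sub>1)], s\<^sub>t)\<close>, so that
  \<open>snd\<close> is the map taking a history to its current state.
\<close>

type_synonym ('p, 'a) history = "(('p, 'a) state \<times> 'a \<times> real) list \<times> ('p, 'a) state"

definition init_history :: "'p \<Rightarrow> ('p, 'a) history" where
  "init_history p = ([], (p, []))"

definition extend_history :: "('p, 'a) history \<Rightarrow> 'a \<Rightarrow> real \<Rightarrow> ('p, 'a) history" where
  "extend_history h a \<rho> = (fst h @ [(snd h, a, \<rho>)], append_step (snd h) a)"

fun histories :: "nat \<Rightarrow> ('p, 'a) history set" where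
  "histories 0 = range init_history"
| "histories (Suc t) = {extend_history h a \<rho> | h a \<rho>. h \<in> histories t}"

text \<open>
  The sigma-algebra on the histories \<open>h\<^sub>t\<close> is the trace of the product sigma-algebra: states and
  actions are discrete, rewards carry the Borel sets.
\<close>

definition history_space :: "nat \<Rightarrow> ('p, 'a) history measure" where
  "history_space t =
     vimage_algebra (histories t) (\<lambda>h. (\<lambda>i\<in>{..<t}. fst h ! i, snd h))
       ((\<Pi>\<^sub>M i\<in>{..<t}. count_space UNIV \<Otimes>\<^sub>M (count_space UNIV \<Otimes>\<^sub>M borel)) \<Otimes>\<^sub>M count_space UNIV)"

text \<open>
  Distributions on the finite action set are of type \<^typ>\<open>'a pmf\<close>; measurability of a map into
  them is measurability of the corresponding probability kernel.
\<close>

definition is_policy :: "nat \<Rightarrow> (('p, 'a) history \<Rightarrow> 'a pmf) \<Rightarrow> bool" where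
  "is_policy T \<pi> \<longleftrightarrow>
     (\<forall>t<T. (\<lambda>h. measure_pmf (\<pi> h)) \<in> history_space t \<rightarrow>\<^sub>M prob_algebra (count_space UNIV))"

text \<open>
  The law of \<open>h\<^sub>t\<close> when \<open>\<pi>\<close> is run in an MDP with reward function \<open>R\<close>. Since the rewards are a
  deterministic function of the discrete states and actions, this law is discrete.
\<close>

fun history_pmf ::
  "'p pmf \<Rightarrow> (('p, 'a) state \<Rightarrow> 'a \<Rightarrow> real) \<Rightarrow> (('p, 'a) history \<Rightarrow> 'a pmf) \<Rightarrow> nat \<Rightarrow>
   ('p, 'a) history pmf" where
  "history_pmf \<sigma> R \<pi> 0 = map_pmf init_history \<sigma>"
| "history_pmf \<sigma> R \<pi> (Suc t) =
     bind_pmf (history_pmf \<sigma> R \<pi> t) (\<lambda>h.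
       map_pmf (\<lambda>a. extend_history h a (R (snd h) a)) (\<pi> h))"

definition return_in ::
  "nat \<Rightarrow> 'p pmf \<Rightarrow> (('p, 'a) state \<Rightarrow> 'a \<Rightarrow> real) \<Rightarrow> (('p, 'a) history \<Rightarrow> 'a pmf) \<Rightarrow> real" where
  "return_in T \<sigma> R \<pi> =
     measure_pmf.expectation (history_pmf \<sigma> R \<pi> T)
       (\<lambda>h. \<Sum>t<T. case fst h ! t of (s, a, _) \<Rightarrow> R s a)"

definition posterior :: "'m measure \<Rightarrow> ('m \<Rightarrow> 'd \<Rightarrow> real) \<Rightarrow> 'd \<Rightarrow> 'm measure" where
  "posterior prior lik D =
     density prior (\<lambda>m. ennreal (lik m D) / (\<integral>\<^sup>+ m'. ennreal (lik m' D) \<partial>prior))"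

definition bayes_objective ::
  "nat \<Rightarrow> 'p pmf \<Rightarrow> ('m \<Rightarrow> ('p, 'a) state \<Rightarrow> 'a \<Rightarrow> real) \<Rightarrow> 'm measure \<Rightarrow>
   (('p, 'a) history \<Rightarrow> 'a pmf) \<Rightarrow> real" where
  "bayes_objective T \<sigma> r P \<pi> = (\<integral>m. return_in T \<sigma> (r m) \<pi> \<partial>P)"

text \<open>
  \<open>b\<close> is a version of the conditional law of the MDP \<open>\<M>\<close> given \<open>h\<^sub>t\<close>, for \<open>\<M>\<close> distributed
  according to \<open>P\<close>: it is a probability kernel with
  \<open>\<bbbE>[1\<^sub>A(\<M>) 1\<^sub>B(h\<^sub>t)] = \<bbbE>[b(h\<^sub>t)(A) 1\<^sub>B(h\<^sub>t)]\<close>.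
  A single kernel serves for all policies generating the history, because the action
  probabilities do not depend on \<open>\<M>\<close>; asking this of every policy determines \<open>b\<close> also after
  actions that some particular policy never takes.
\<close>

definition is_belief ::
  "nat \<Rightarrow> 'p pmf \<Rightarrow> ('m \<Rightarrow> ('p, 'a) state \<Rightarrow> 'a \<Rightarrow> real) \<Rightarrow> 'm measure \<Rightarrow>
   (('p, 'a) history \<Rightarrow> 'm measure) \<Rightarrow> bool" where
  "is_belief T \<sigma> r P b \<longleftrightarrow>
     (\<forall>t\<le>T. b \<in> history_space t \<rightarrow>\<^sub>M prob_algebra P \<and>
       (\<forall>\<pi>. is_policy T \<pi> \<longrightarrow> (\<forall>A\<in>sets P. \<forall>B\<in>sets (history_space t).
          (\<integral>\<^sup>+ m. (\<integral>\<^sup>+ h. indicator A m * indicator B h \<partial>history_pmf \<sigma> (r m) \<pi> t) \<partial>P) =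
          (\<integral>\<^sup>+ m. (\<integral>\<^sup>+ h. emeasure (b h) A * indicator B h \<partial>history_pmf \<sigma> (r m) \<pi> t) \<partial>P))))"

definition uncertainty_adaptive ::
  "nat \<Rightarrow> 'm measure \<Rightarrow> (('p, 'a) history \<Rightarrow> 'm measure) \<Rightarrow>
   (('p, 'a) history \<Rightarrow> 'a pmf) \<Rightarrow> bool" where
  "uncertainty_adaptive T MM b \<pi> \<longleftrightarrow>
     (\<exists>\<mu> :: ('p, 'a) state \<times> 'm measure \<Rightarrow> 'a pmf.
        (\<lambda>x. measure_pmf (\<mu> x)) \<in>
          count_space (states T) \<Otimes>\<^sub>M prob_algebra MM \<rightarrow>\<^sub>M prob_algebra (count_space UNIV) \<and>
        (\<forall>t<T. \<forall>h\<in>histories t. \<forall>a. pmf (\<pi> h) a = pmf (\<mu> (snd h, b h)) a))"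

end

theory Submission
  imports Defs
begin

text \<open>
  Rewards are deterministic functions of the MDP, so almost surely the belief \<open>b(h\<^sub>t)\<close> is
  concentrated on the MDPs that reproduce the rewards observed in \<open>h\<^sub>t\<close>. The reward after step
  \<open>i\<close> is therefore the mean of \<open>r(s\<^sub>i, a\<^sub>i)\<close> under the belief, and since the state contains the
  prompt and all actions, the pair \<open>(s(h\<^sub>t), b(h\<^sub>t))\<close> almost surely determines the whole
  history. Dynamic programming over histories, with \<open>b(h\<^sub>t)\<close> as the conditional law of the
  MDP, gives a deterministic optimal policy; evaluated at the history reconstructed from state and
  belief it becomes uncertainty-adaptive without losing value.
\<close>

subsection \<open>Uniqueness of integral functionals\<close>

text \<open>
  The laws of histories live on the discrete sigma-algebra rather than on \<^const>\<open>history_space\<close>,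
  so the iterated integrals over MDPs and histories are treated as functionals instead of as
  integrals with respect to one joint measure.
\<close>

definition integral_functional :: "'x measure \<Rightarrow> (('x \<Rightarrow> ennreal) \<Rightarrow> ennreal) \<Rightarrow> bool" where
  "integral_functional M J \<longleftrightarrow>
     (\<forall>f g. (\<forall>x\<in>space M. f x = g x) \<longrightarrow> J f = J g) \<and>
     (\<forall>c. \<forall>f\<in>borel_measurable M. J (\<lambda>x. c * f x) = c * J f) \<and>
     (\<forall>f\<in>borel_measurable M. \<forall>g\<in>borel_measurable M. J (\<lambda>x. f x + g x) = J f + J g) \<and>
     (\<forall>F. (\<forall>i::nat. F i \<in> borel_measurable M) \<longrightarrow> incseq F \<longrightarrow>
        J (\<lambda>x. SUP i. F i x) = (SUP i. J (F i)))"

lemma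
  assumes "integral_functional M J"
  shows integral_functional_cong: "(\<And>x. x \<in> space M \<Longrightarrow> f x = g x) \<Longrightarrow> J f = J g"
    and integral_functional_cmult: "f \<in> borel_measurable M \<Longrightarrow> J (\<lambda>x. c * f x) = c * J f"
    and integral_functional_add: "f \<in> borel_measurable M \<Longrightarrow> g \<in> borel_measurable M \<Longrightarrow>
      J (\<lambda>x. f x + g x) = J f + J g"
    and integral_functional_SUP: "(\<And>i::nat. F i \<in> borel_measurable M) \<Longrightarrow> incseq F \<Longrightarrow>
      J (\<lambda>x. SUP i. F i x) = (SUP i. J (F i))"
  using assms unfolding integral_functional_def by blast+

lemma integral_functional_suminf:
  assumes J: "integral_functional M J" and f[measurable]: "\<And>i::nat. f i \<in> borel_measurable M"
  shows "J (\<lambda>x. \<Sum>i. f i x) = (\<Sum>i. J (f i))"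
proof -
  have zero: "J (\<lambda>x. 0) = 0"
    using integral_functional_cmult[OF J, of "\<lambda>x. 0" 0] by simp
  have fin: "J (\<lambda>x. \<Sum>i<n. f i x) = (\<Sum>i<n. J (f i))" for n
    by (induction n) (simp_all add: zero integral_functional_add[OF J])
  have "J (\<lambda>x. \<Sum>i. f i x) = J (\<lambda>x. SUP n. \<Sum>i<n. f i x)"
    by (simp add: suminf_eq_SUP)
  also have "\<dots> = (SUP n. J (\<lambda>x. \<Sum>i<n. f i x))"
    by (intro integral_functional_SUP[OF J])
      (auto intro!: incseq_SucI simp: le_fun_def)
  also have "\<dots> = (\<Sum>i. J (f i))"
    by (simp add: fin suminf_eq_SUP)
  finally show ?thesis .
qed

text \<open>Dynkin's theorem carries agreement from the intersection-stable generator
  \<open>G\<close> to all measurable sets; linearity and monotone limits then carry it to all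
  nonnegative measurable functions. Finite total mass allows the complement step to
  subtract.\<close>

lemma integral_functional_eqI:
  assumes I: "integral_functional M I" and J: "integral_functional M J"
    and G: "sets M = sigma_sets (space M) G" "Int_stable G" "G \<subseteq> Pow (space M)"
    and eq: "\<And>A. A \<in> G \<Longrightarrow> I (indicator A) = J (indicator A)"
    and tot: "I (indicator (space M)) = J (indicator (space M))" "J (indicator (space M)) < \<infinity>"
    and f: "f \<in> borel_measurable M"
  shows "I f = J f"
proof -
  have zero: "K (\<lambda>x. 0) = 0" if "integral_functional M K" for K
    using integral_functional_cmult[OF that, of "\<lambda>x. 0" 0] by simp
  have sets: "I (indicator A) = J (indicator A)" if A: "A \<in> sets M" for A
    using G(2,3) A[unfolded G(1)]
  proof (induction rule: sigma_sets_induct_disjoint)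
    case (basic A)
    then show ?case by (rule eq)
  next
    case empty
    then show ?case by (simp add: zero[OF I] zero[OF J])
  next
    case (compl A)
    then have [measurable]: "A \<in> sets M" by (simp add: G(1))
    have split: "K (indicator (space M)) = K (indicator A) + K (indicator (space M - A))"
      if K: "integral_functional M K" for K
    proof -
      have "K (indicator (space M)) = K (\<lambda>x. indicator A x + indicator (space M - A) x)"
        by (intro integral_functional_cong[OF K]) (auto split: split_indicator)
      then show ?thesis by (simp add: integral_functional_add[OF K])
    qed
    have "J (indicator A) < \<infinity>"
      using split[OF J] tot(2) by (simp add: less_top)
    then show ?case
      using split[OF I] split[OF J] tot(1) compl
      by (metis ennreal_add_left_cancel infinity_ennreal_def less_irrefl)
  next
    case (union A)
    then have [measurable]: "A i \<in> sets M" for i by (auto simp: G(1))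
    have "K (indicator (\<Union>i. A i)) = (\<Sum>i. K (indicator (A i)))"
      if K: "integral_functional M K" for K
    proof -
      have "K (indicator (\<Union>i. A i)) = K (\<lambda>x. \<Sum>i. indicator (A i) x)"
        by (intro integral_functional_cong[OF K]) (simp add: suminf_indicator union)
      then show ?thesis by (simp add: integral_functional_suminf[OF K])
    qed
    from this[OF I] this[OF J] show ?case by (simp only: union)
  qed
  show ?thesis
    using f
  proof induction
    case (cong f g)
    then show ?case
      using integral_functional_cong[OF I, of f g] integral_functional_cong[OF J, of f g] by simp
  next
    case (set A)
    then show ?case by (rule sets)
  next
    case (mult u c)
    then show ?case by (simp add: integral_functional_cmult[OF I] integral_functional_cmult[OF J])
  next
    case (add u v)
    then show ?case by (simp add: integral_functional_add[OF I] integral_functional_add[OF J])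
  next
    case (seq U)
    then show ?case
      using integral_functional_SUP[OF I, of U] integral_functional_SUP[OF J, of U]
      by (simp add: image_comp comp_def SUP_apply)
  qed
qed

text \<open>The analogue of pushing a measure through a kernel. In \<open>belief_integral\<close>
  the kernel keeps the history and redraws the MDP from its belief.\<close>

lemma integral_functional_kernel:
  assumes J: "integral_functional M J" and K[measurable]: "K \<in> M \<rightarrow>\<^sub>M subprob_algebra N"
  shows "integral_functional N (\<lambda>f. J (\<lambda>x. \<integral>\<^sup>+y. f y \<partial>K x))"
proof -
  have sp: "space (K x) = space N" and st: "borel_measurable (K x) = (borel_measurable N :: ('b \<Rightarrow> ennreal) set)"
    if "x \<in> space M" for x
    using subprob_measurableD[OF K that] by (auto intro: measurable_cong_sets)
  show ?thesis
    unfolding integral_functional_def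
  proof (intro conjI allI ballI impI)
    fix f g :: "'b \<Rightarrow> ennreal" assume "\<forall>x\<in>space N. f x = g x"
    then show "J (\<lambda>x. \<integral>\<^sup>+y. f y \<partial>K x) = J (\<lambda>x. \<integral>\<^sup>+y. g y \<partial>K x)"
      by (intro integral_functional_cong[OF J] nn_integral_cong) (simp add: sp)
  next
    fix c and f :: "'b \<Rightarrow> ennreal" assume f[measurable]: "f \<in> borel_measurable N"
    have "J (\<lambda>x. \<integral>\<^sup>+y. c * f y \<partial>K x) = J (\<lambda>x. c * (\<integral>\<^sup>+y. f y \<partial>K x))"
      by (intro integral_functional_cong[OF J] nn_integral_cmult) (simp add: st)
    then show "J (\<lambda>x. \<integral>\<^sup>+y. c * f y \<partial>K x) = c * J (\<lambda>x. \<integral>\<^sup>+y. f y \<partial>K x)"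
      by (simp add: integral_functional_cmult[OF J])
  next
    fix f g :: "'b \<Rightarrow> ennreal"
    assume [measurable]: "f \<in> borel_measurable N" "g \<in> borel_measurable N"
    have "J (\<lambda>x. \<integral>\<^sup>+y. f y + g y \<partial>K x) = J (\<lambda>x. (\<integral>\<^sup>+y. f y \<partial>K x) + (\<integral>\<^sup>+y. g y \<partial>K x))"
      by (intro integral_functional_cong[OF J] nn_integral_add) (simp_all add: st)
    then show "J (\<lambda>x. \<integral>\<^sup>+y. f y + g y \<partial>K x) = J (\<lambda>x. \<integral>\<^sup>+y. f y \<partial>K x) + J (\<lambda>x. \<integral>\<^sup>+y. g y \<partial>K x)"
      by (simp add: integral_functional_add[OF J])
  next
    fix F :: "nat \<Rightarrow> 'b \<Rightarrow> ennreal"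
    assume F: "\<forall>i. F i \<in> borel_measurable N" and inc: "incseq F"
    have [measurable]: "F i \<in> borel_measurable N" for i using F by simp
    have "J (\<lambda>x. \<integral>\<^sup>+y. (SUP i. F i y) \<partial>K x) = J (\<lambda>x. SUP i. \<integral>\<^sup>+y. F i y \<partial>K x)"
      by (intro integral_functional_cong[OF J] nn_integral_monotone_convergence_SUP inc) (simp add: st)
    also have "\<dots> = (SUP i. J (\<lambda>x. \<integral>\<^sup>+y. F i y \<partial>K x))"
      using inc by (intro integral_functional_SUP[OF J])
        (auto simp: incseq_def le_fun_def intro!: nn_integral_mono)
    finally show "J (\<lambda>x. \<integral>\<^sup>+y. (SUP i. F i y) \<partial>K x) = (SUP i. J (\<lambda>x. \<integral>\<^sup>+y. F i y \<partial>K x))" .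
  qed
qed

subsection \<open>Histories\<close>

lemma length_fst_histories: "h \<in> histories t \<Longrightarrow> length (fst h) = t"
  by (induction t arbitrary: h) (auto simp: init_history_def extend_history_def)

lemma length_snd_histories: "h \<in> histories t \<Longrightarrow> length (snd (snd h)) = t"
  by (induction t arbitrary: h) (auto simp: init_history_def extend_history_def append_step_def)

text \<open>Transitions only append, so the state at time \<open>i\<close> on a path ending in
  \<open>s\<close> is this truncation.\<close>

definition prefix_state :: "('p, 'a) state \<Rightarrow> nat \<Rightarrow> ('p, 'a) state" where
  "prefix_state s i = (fst s, take i (snd s))"

text \<open>A state already lists the prompt and every action, so the rewards are the only further
  information in a history. This assembles the history from both.\<close>

definition history_of :: "('p, 'a) state \<Rightarrow> (nat \<Rightarrow> real) \<Rightarrow> ('p, 'a) history" where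
  "history_of s \<rho> = (map (\<lambda>i. (prefix_state s i, snd s ! i, \<rho> i)) [0..<length (snd s)], s)"

abbreviation reward_at :: "('p, 'a) history \<Rightarrow> nat \<Rightarrow> real" where
  "reward_at h i \<equiv> snd (snd (fst h ! i))"

lemma snd_history_of [simp]: "snd (history_of s \<rho>) = s"
  by (simp add: history_of_def)

lemma history_of_append_step:
  "history_of (append_step s a) \<rho> = extend_history (history_of s \<rho>) a (\<rho> (length (snd s)))"
  by (auto simp: history_of_def extend_history_def append_step_def prefix_state_def nth_append)

lemma history_of_cong:
  "(\<And>i. i < length (snd s) \<Longrightarrow> \<rho> i = \<rho>' i) \<Longrightarrow> history_of s \<rho> = history_of s \<rho>'"
  by (simp add: history_of_def)

lemma history_of_in_histories: "history_of s \<rho> \<in> histories (length (snd s))"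
proof -
  have "history_of (p, as) \<rho> \<in> histories (length as)" for p as
  proof (induction as rule: rev_induct)
    case Nil
    then show ?case by (auto simp: history_of_def init_history_def)
  next
    case (snoc a as)
    then show ?case
      using history_of_append_step[of "(p, as)" a \<rho>]
      by (auto simp: append_step_def simp del: split_paired_Ex)
  qed
  from this[of "fst s" "snd s"] show ?thesis by simp
qed

lemma history_of_rewards: "h \<in> histories t \<Longrightarrow> history_of (snd h) (reward_at h) = h"
proof (induction t arbitrary: h)
  case 0
  then show ?case by (auto simp: history_of_def init_history_def)
next
  case (Suc t)
  then obtain g a \<rho> where g: "g \<in> histories t" and h: "h = extend_history g a \<rho>" by auto
  have len: "length (fst g) = t" "length (snd (snd g)) = t"
    using g by (simp_all add: length_fst_histories length_snd_histories)
  have "history_of (snd h) (reward_at h) = extend_history (history_of (snd g) (reward_at h)) a \<rho>"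
    using len by (simp add: h extend_history_def history_of_append_step nth_append)
  also have "history_of (snd g) (reward_at h) = history_of (snd g) (reward_at g)"
    using len by (intro history_of_cong) (simp add: h extend_history_def nth_append)
  finally show ?case using Suc.IH[OF g] h by simp
qed

lemma extend_history_in_histories: "h \<in> histories t \<Longrightarrow> extend_history h a \<rho> \<in> histories (Suc t)"
  by (simp only: histories.simps) blast

section \<open>Measurability on the space of histories\<close>

lemma space_history_space [simp]: "space (history_space t) = histories t"
  by (simp add: history_space_def)

text \<open>A map into a \<open>vimage_algebra\<close> is tested through the generating map, whose
  components are the first \<open>t\<close> steps and the final state.\<close>

lemma measurable_history_spaceI:
  assumes h: "\<And>x. x \<in> space M \<Longrightarrow> f x \<in> histories t"
    and steps: "\<And>i. i < t \<Longrightarrow>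
      (\<lambda>x. fst (f x) ! i) \<in> M \<rightarrow>\<^sub>M count_space UNIV \<Otimes>\<^sub>M (count_space UNIV \<Otimes>\<^sub>M borel)"
    and state: "(\<lambda>x. snd (f x)) \<in> M \<rightarrow>\<^sub>M count_space UNIV"
  shows "f \<in> M \<rightarrow>\<^sub>M history_space t"
  unfolding history_space_def
proof (rule measurable_vimage_algebra2)
  show "f \<in> space M \<rightarrow> histories t" using h by auto
  show "(\<lambda>x. (\<lambda>i\<in>{..<t}. fst (f x) ! i, snd (f x))) \<in> M \<rightarrow>\<^sub>M
      (\<Pi>\<^sub>M i\<in>{..<t}. count_space UNIV \<Otimes>\<^sub>M (count_space UNIV \<Otimes>\<^sub>M borel)) \<Otimes>\<^sub>M count_space UNIV"
    using steps by (intro measurable_Pair measurable_restrict state) auto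
qed

lemma measurable_history_coordinates:
  "(\<lambda>h. (\<lambda>i\<in>{..<t}. fst h ! i, snd h)) \<in> history_space t \<rightarrow>\<^sub>M
     (\<Pi>\<^sub>M i\<in>{..<t}. count_space UNIV \<Otimes>\<^sub>M (count_space UNIV \<Otimes>\<^sub>M borel)) \<Otimes>\<^sub>M count_space UNIV"
  unfolding history_space_def
  by (rule measurable_vimage_algebra1) (auto simp: space_pair_measure space_PiM)

lemma measurable_history_step:
  assumes "i < t"
  shows "(\<lambda>h. fst h ! i) \<in> history_space t \<rightarrow>\<^sub>M count_space UNIV \<Otimes>\<^sub>M (count_space UNIV \<Otimes>\<^sub>M borel)"
proof -
  have "(\<lambda>h. fst (\<lambda>i\<in>{..<t}. fst h ! i, snd h) i) \<in> history_space t \<rightarrow>\<^sub>M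
      count_space UNIV \<Otimes>\<^sub>M (count_space UNIV \<Otimes>\<^sub>M borel)"
    using assms
    by (intro measurable_compose[OF measurable_compose[OF measurable_history_coordinates measurable_fst]
          measurable_component_singleton]) simp
  then show ?thesis using assms by simp
qed

lemma measurable_history_state [measurable]: "snd \<in> history_space t \<rightarrow>\<^sub>M count_space UNIV"
  using measurable_compose[OF measurable_history_coordinates measurable_snd] by simp

lemma measurable_reward_at [measurable]: "i < t \<Longrightarrow> (\<lambda>h. reward_at h i) \<in> borel_measurable (history_space t)"
  by (rule measurable_compose[OF measurable_history_step]) measurable

text \<open>The appended reward varies with \<open>x\<close> along with the history, because in the
  application it is computed from the unknown MDP.\<close>

lemma measurable_extend_history:
  fixes f :: "'x \<Rightarrow> ('p::countable, 'a::finite) history"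
  assumes f[measurable]: "f \<in> M \<rightarrow>\<^sub>M history_space t" and \<rho>[measurable]: "\<rho> \<in> borel_measurable M"
  shows "(\<lambda>x. extend_history (f x) a (\<rho> x)) \<in> M \<rightarrow>\<^sub>M history_space (Suc t)"
proof (rule measurable_history_spaceI)
  fix x assume "x \<in> space M"
  then show "extend_history (f x) a (\<rho> x) \<in> histories (Suc t)"
    using measurable_space[OF f] by (auto simp del: histories.simps intro: extend_history_in_histories)
next
  have [measurable]: "(\<lambda>x. snd (f x)) \<in> M \<rightarrow>\<^sub>M count_space UNIV"
    by (rule measurable_compose[OF f measurable_history_state])
  show "(\<lambda>x. snd (extend_history (f x) a (\<rho> x))) \<in> M \<rightarrow>\<^sub>M count_space UNIV"
    by (simp add: extend_history_def)
  fix i assume i: "i < Suc t"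
  have len: "length (fst (f x)) = t" if "x \<in> space M" for x
    using measurable_space[OF f that] by (simp add: length_fst_histories)
  show "(\<lambda>x. fst (extend_history (f x) a (\<rho> x)) ! i) \<in>
      M \<rightarrow>\<^sub>M count_space UNIV \<Otimes>\<^sub>M (count_space UNIV \<Otimes>\<^sub>M borel)"
  proof (cases "i = t")
    case True
    have "(\<lambda>x. (snd (f x), a, \<rho> x)) \<in> M \<rightarrow>\<^sub>M count_space UNIV \<Otimes>\<^sub>M (count_space UNIV \<Otimes>\<^sub>M borel)"
      by measurable
    then show ?thesis
      by (rule measurable_cong[THEN iffD1, rotated]) (use True len in \<open>simp add: extend_history_def nth_append\<close>)
  next
    case False
    then have "(\<lambda>x. fst (f x) ! i) \<in> M \<rightarrow>\<^sub>M count_space UNIV \<Otimes>\<^sub>M (count_space UNIV \<Otimes>\<^sub>M borel)"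
      using i by (intro measurable_compose[OF f measurable_history_step]) simp
    then show ?thesis
      by (rule measurable_cong[THEN iffD1, rotated])
        (use i False len in \<open>simp add: extend_history_def nth_append\<close>)
  qed
qed

section \<open>Laws of histories under a policy\<close>

lemma set_history_pmf: "set_pmf (history_pmf \<sigma> R \<pi> t) \<subseteq> histories t"
  by (induction t) (auto simp: image_subset_iff simp del: split_paired_Ex)

text \<open>Each extension appends the reward prescribed by \<open>R\<close> and leaves earlier
  prefixes of the state intact, so on the support every step is a function of the final
  state.\<close>

lemma rewards_history_pmf:
  assumes "h \<in> set_pmf (history_pmf \<sigma> R \<pi> t)" "i < t"
  shows "fst h ! i = (prefix_state (snd h) i, snd (snd h) ! i, R (prefix_state (snd h) i) (snd (snd h) ! i))"
  using assms
proof (induction t arbitrary: h)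
  case (Suc t)
  then obtain g a where g: "g \<in> set_pmf (history_pmf \<sigma> R \<pi> t)"
    and h: "h = extend_history g a (R (snd g) a)"
    by (auto simp del: split_paired_Ex)
  have len: "length (fst g) = t" "length (snd (snd g)) = t"
    using subsetD[OF set_history_pmf g] by (simp_all add: length_fst_histories length_snd_histories)
  show ?case
  proof (cases "i = t")
    case True
    then show ?thesis using len
      by (simp add: h extend_history_def append_step_def prefix_state_def nth_append)
  next
    case False
    then show ?thesis using len Suc.prems Suc.IH[OF g]
      by (simp add: h extend_history_def append_step_def prefix_state_def nth_append)
  qed
qed simp

lemma measurable_pmf_policy:
  assumes "is_policy T \<pi>" "t < T"
  shows "(\<lambda>h. pmf (\<pi> h) a) \<in> borel_measurable (history_space t)"
proof -
  have "(\<lambda>h. measure (measure_pmf (\<pi> h)) {a}) \<in> borel_measurable (history_space t)"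
    using assms unfolding is_policy_def
    by (intro measurable_compose[OF _ measurable_measure_prob_algebra]) auto
  then show ?thesis by (simp add: pmf.rep_eq)
qed

lemma nn_integral_pmf_finite_type:
  fixes p :: "'a::finite pmf"
  shows "(\<integral>\<^sup>+x. f x \<partial>measure_pmf p) = (\<Sum>x\<in>UNIV. f x * pmf p x)"
  by (rule nn_integral_measure_pmf_support) auto

subsection \<open>The belief as a disintegration\<close>

text \<open>\<open>P\<close> stands for the posterior and \<open>b\<close> for one fixed version of
  the belief. The bound on the rewards is added in a later context, where real-valued returns
  appear.\<close>

locale bayesian_mdp = prob_space P for P :: "'m measure" +
  fixes T :: nat
    and \<sigma> :: "'p :: countable pmf"
    and r :: "'m \<Rightarrow> ('p, 'a :: finite) state \<Rightarrow> 'a \<Rightarrow> real"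
    and b :: "('p, 'a) history \<Rightarrow> 'm measure"
  assumes measurable_reward_fixed: "s \<in> states T \<Longrightarrow> (\<lambda>m. r m s a) \<in> borel_measurable P"
    and belief: "is_belief T \<sigma> r P b"
begin

lemma measurable_belief: "t \<le> T \<Longrightarrow> b \<in> history_space t \<rightarrow>\<^sub>M prob_algebra P"
  using belief by (simp add: is_belief_def)

lemma prob_space_belief: "t \<le> T \<Longrightarrow> h \<in> histories t \<Longrightarrow> prob_space (b h)"
  and sets_belief: "t \<le> T \<Longrightarrow> h \<in> histories t \<Longrightarrow> sets (b h) = sets P"
  using measurable_space[OF measurable_belief, of t h] by (auto simp: space_prob_algebra)

text \<open>State and action take countably many values, which reduces the claim to measurability in
  the MDP for each fixed state in \<open>states T\<close> and each fixed action.\<close>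

lemma measurable_reward:
  assumes "f \<in> M \<rightarrow>\<^sub>M P" "s \<in> M \<rightarrow>\<^sub>M count_space UNIV" "a \<in> M \<rightarrow>\<^sub>M count_space UNIV"
    and "\<And>x. x \<in> space M \<Longrightarrow> s x \<in> states T"
  shows "(\<lambda>x. r (f x) (s x) (a x)) \<in> borel_measurable M"
proof (rule measurable_compose_countable'[where I="states T" and g=s])
  show "s \<in> M \<rightarrow>\<^sub>M count_space (states T)"
    using assms(2,4) by (simp add: measurable_count_space_eq_countable) (auto intro: measurable_sets)
  fix s' :: "('p, 'a) state" assume "s' \<in> states T"
  then show "(\<lambda>x. r (f x) s' (a x)) \<in> borel_measurable M"
    by (intro measurable_compose_countable[OF measurable_compose[OF assms(1)] assms(3)]
        measurable_reward_fixed)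
qed simp

lemma measurable_next_history:
  assumes "t < T" "f \<in> M \<rightarrow>\<^sub>M P" and h: "g \<in> M \<rightarrow>\<^sub>M history_space t"
  shows "(\<lambda>x. extend_history (g x) a (r (f x) (snd (g x)) a)) \<in> M \<rightarrow>\<^sub>M history_space (Suc t)"
proof (intro measurable_extend_history measurable_reward assms measurable_const)
  show "(\<lambda>x. snd (g x)) \<in> M \<rightarrow>\<^sub>M count_space UNIV"
    by (rule measurable_compose[OF h measurable_history_state])
  show "snd (g x) \<in> states T" if "x \<in> space M" for x
    using measurable_space[OF h that] \<open>t < T\<close> by (simp add: states_def length_snd_histories)
qed simp

text \<open>Both the integrand and the law vary with \<open>m\<close>. The induction absorbs the
  last step into the integrand as a finite sum over actions, and therefore runs over all jointly
  measurable \<open>f\<close>.\<close>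

lemma measurable_history_integral:
  assumes \<pi>: "is_policy T \<pi>" and "t \<le> T" and "f \<in> borel_measurable (P \<Otimes>\<^sub>M history_space t)"
  shows "(\<lambda>m. \<integral>\<^sup>+h. f (m, h) \<partial>history_pmf \<sigma> (r m) \<pi> t) \<in> borel_measurable P"
  using assms(2,3)
proof (induction t arbitrary: f)
  case 0
  have "(\<lambda>x. (fst x, init_history (snd x))) \<in> P \<Otimes>\<^sub>M measure_pmf \<sigma> \<rightarrow>\<^sub>M P \<Otimes>\<^sub>M history_space 0"
    by (intro measurable_Pair measurable_fst measurable_compose[OF measurable_snd]) simp
  from measurable_compose[OF this 0(2)] show ?case
    by (simp add: measure_pmf.borel_measurable_nn_integral split_beta')
next
  case (Suc t)
  then have t: "t < T" by simp
  define g where "g = (\<lambda>(m, h). \<Sum>a\<in>UNIV. f (m, extend_history h a (r m (snd h) a)) * ennreal (pmf (\<pi> h) a))"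
  have "(\<lambda>x. f (fst x, extend_history (snd x) a (r (fst x) (snd (snd x)) a))) \<in>
      borel_measurable (P \<Otimes>\<^sub>M history_space t)" for a
    by (intro measurable_compose[OF _ Suc.prems(2)] measurable_Pair measurable_fst
        measurable_next_history t measurable_snd)
  moreover have "(\<lambda>x. pmf (\<pi> (snd x)) a) \<in> borel_measurable (P \<Otimes>\<^sub>M history_space t)" for a
    by (intro measurable_compose[OF measurable_snd measurable_pmf_policy[OF \<pi> t]])
  ultimately have "g \<in> borel_measurable (P \<Otimes>\<^sub>M history_space t)"
    by (simp add: g_def split_beta')
  from Suc.IH[OF _ this] t show ?case
    by (simp add: g_def nn_integral_pmf_finite_type)
qed

text \<open>Comparison on the support suffices, and it is there that the rewards in \<open>h\<close>
  are known to come from \<open>r m\<close>.\<close>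

lemma history_integral_mono:
  assumes "\<And>m h. m \<in> space P \<Longrightarrow> h \<in> set_pmf (history_pmf \<sigma> (r m) \<pi> t) \<Longrightarrow> f m h \<le> g m h"
  shows "(\<integral>\<^sup>+m. \<integral>\<^sup>+h. f m h \<partial>history_pmf \<sigma> (r m) \<pi> t \<partial>P)
       \<le> (\<integral>\<^sup>+m. \<integral>\<^sup>+h. g m h \<partial>history_pmf \<sigma> (r m) \<pi> t \<partial>P)"
  by (rule nn_integral_mono, rule nn_integral_mono_AE, rule AE_pmfI, rule assms)

lemma history_integral_cong:
  assumes "\<And>m h. m \<in> space P \<Longrightarrow> h \<in> histories t \<Longrightarrow> f m h = g m h"
  shows "(\<integral>\<^sup>+m. \<integral>\<^sup>+h. f m h \<partial>history_pmf \<sigma> (r m) \<pi> t \<partial>P)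
       = (\<integral>\<^sup>+m. \<integral>\<^sup>+h. g m h \<partial>history_pmf \<sigma> (r m) \<pi> t \<partial>P)"
  by (intro antisym history_integral_mono) (use assms subsetD[OF set_history_pmf] in force)+

text \<open>The history law is discrete, so the inner integral is linear and continuous along
  increasing sequences for every integrand; \<open>measurable_history_integral\<close> supplies the
  measurability for the outer integral.\<close>

lemma integral_functional_joint:
  assumes \<pi>: "is_policy T \<pi>" and t: "t \<le> T"
  shows "integral_functional (P \<Otimes>\<^sub>M history_space t)
           (\<lambda>f. \<integral>\<^sup>+m. \<integral>\<^sup>+h. f (m, h) \<partial>history_pmf \<sigma> (r m) \<pi> t \<partial>P)"
    (is "integral_functional ?M ?J")
  unfolding integral_functional_def
proof (intro conjI allI ballI impI)
  note m = measurable_history_integral[OF \<pi> t]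
  fix f g :: "'m \<times> ('p, 'a) history \<Rightarrow> ennreal"
  show "?J f = ?J g" if "\<forall>x\<in>space ?M. f x = g x"
    by (intro history_integral_cong bspec[OF that]) (simp add: space_pair_measure)
  show "?J (\<lambda>x. c * f x) = c * ?J f" if "f \<in> borel_measurable ?M" for c
    by (simp add: nn_integral_cmult m[OF that])
  show "?J (\<lambda>x. f x + g x) = ?J f + ?J g"
    if "f \<in> borel_measurable ?M" "g \<in> borel_measurable ?M"
    by (simp add: nn_integral_add that[THEN m])
next
  fix F :: "nat \<Rightarrow> 'm \<times> ('p, 'a) history \<Rightarrow> ennreal"
  assume F: "\<forall>i. F i \<in> borel_measurable ?M" and inc: "incseq F"
  have le: "F i x \<le> F j x" if "i \<le> j" for i j x
    using inc that by (simp only: incseq_def le_fun_def)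
  have inc1: "incseq (\<lambda>i h. F i (m, h))" for m
    by (intro monoI le_funI le)
  have inc2: "incseq (\<lambda>i m. \<integral>\<^sup>+h. F i (m, h) \<partial>history_pmf \<sigma> (r m) \<pi> t)"
    by (intro monoI le_funI nn_integral_mono le)
  show "?J (\<lambda>x. SUP i. F i x) = (SUP i. ?J (F i))"
    using F measurable_history_integral[OF \<pi> t]
    by (simp add: nn_integral_monotone_convergence_SUP inc1 inc2)
qed

lemma measurable_belief_integral:
  assumes t: "t \<le> T" and f: "f \<in> borel_measurable (P \<Otimes>\<^sub>M history_space t)"
  shows "(\<lambda>h. \<integral>\<^sup>+m. f (m, h) \<partial>b h) \<in> borel_measurable (history_space t)"
proof -
  have "(\<lambda>(h, m). f (m, h)) \<in> borel_measurable (history_space t \<Otimes>\<^sub>M P)"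
    using measurable_compose[OF measurable_pair_swap' f] by (simp add: split_beta')
  from nn_integral_measurable_subprob_algebra2[OF this measurable_prob_algebraD[OF measurable_belief[OF t]]]
  show ?thesis .
qed

text \<open>A tower property: the true MDP may be replaced by one drawn from the belief at
  \<open>h\<close>. The definition of the belief asserts this for rectangles, and
  \<open>integral_functional_eqI\<close> extends it to jointly measurable functions.\<close>

lemma belief_integral:
  assumes \<pi>: "is_policy T \<pi>" and t: "t \<le> T" and f: "f \<in> borel_measurable (P \<Otimes>\<^sub>M history_space t)"
  shows "(\<integral>\<^sup>+m. \<integral>\<^sup>+h. f (m, h) \<partial>history_pmf \<sigma> (r m) \<pi> t \<partial>P)
       = (\<integral>\<^sup>+m. \<integral>\<^sup>+h. (\<integral>\<^sup>+m'. f (m', h) \<partial>b h) \<partial>history_pmf \<sigma> (r m) \<pi> t \<partial>P)"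
proof -
  let ?M = "P \<Otimes>\<^sub>M history_space t"
  let ?J = "\<lambda>f. \<integral>\<^sup>+m. \<integral>\<^sup>+h. f (m, h) \<partial>history_pmf \<sigma> (r m) \<pi> t \<partial>P"
  let ?G = "{A \<times> B |A B. A \<in> sets P \<and> B \<in> sets (history_space t)}"
  \<comment> \<open>\<open>K\<close> keeps the history of \<open>x\<close> and redraws the MDP from
    the belief there, so integrating against \<open>K\<close> first gives the right-hand
    side.\<close>
  define K where "K x = distr (b (snd x)) ?M (\<lambda>m'. (m', snd x))" for x :: "'m \<times> ('p, 'a) history"
  have K: "K \<in> ?M \<rightarrow>\<^sub>M subprob_algebra ?M"
    unfolding K_def
  proof (rule measurable_distr2)
    show "(\<lambda>x. b (snd x)) \<in> ?M \<rightarrow>\<^sub>M subprob_algebra P"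
      by (rule measurable_compose[OF measurable_snd measurable_prob_algebraD[OF measurable_belief[OF t]]])
    have "(\<lambda>z. (snd z, snd (fst z))) \<in> ?M \<Otimes>\<^sub>M P \<rightarrow>\<^sub>M ?M"
      by (intro measurable_Pair measurable_snd measurable_compose[OF measurable_fst measurable_snd])
    then show "(\<lambda>(x, y). (y, snd x)) \<in> ?M \<Otimes>\<^sub>M P \<rightarrow>\<^sub>M ?M"
      by (simp only: split_beta')
  qed
  note joint = integral_functional_joint[OF \<pi> t]
  have J_K: "?J (\<lambda>x. \<integral>\<^sup>+y. g y \<partial>K x)
      = (\<integral>\<^sup>+m. \<integral>\<^sup>+h. (\<integral>\<^sup>+m'. g (m', h) \<partial>b h) \<partial>history_pmf \<sigma> (r m) \<pi> t \<partial>P)"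
    if g: "g \<in> borel_measurable ?M" for g
  proof (rule history_integral_cong)
    fix m and h :: "('p, 'a) history" assume h: "h \<in> histories t"
    have "(\<lambda>m'. (m', h)) \<in> b h \<rightarrow>\<^sub>M ?M"
      using h sets_belief[OF t h]
      by (intro measurable_Pair measurable_const) (simp_all add: measurable_ident_sets)
    then show "(\<integral>\<^sup>+y. g y \<partial>K (m, h)) = (\<integral>\<^sup>+m'. g (m', h) \<partial>b h)"
      using g by (simp add: K_def nn_integral_distr)
  qed
  have "?J f = ?J (\<lambda>x. \<integral>\<^sup>+y. f y \<partial>K x)"
  proof (rule integral_functional_eqI[OF joint integral_functional_kernel[OF joint K]
        _ Int_stable_pair_measure_generator _ _ _ _ f])
    show "sets ?M = sigma_sets (space ?M) ?G"
      by (simp add: sets_pair_measure space_pair_measure)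
    show G: "?G \<subseteq> Pow (space ?M)"
      by (auto simp only: space_pair_measure dest: sets.sets_into_space)
    show rect: "?J (indicator C) = ?J (\<lambda>x. \<integral>\<^sup>+y. indicator C y \<partial>K x)" if C_in: "C \<in> ?G" for C
    proof -
      obtain A B where C: "C = A \<times> B" and A: "A \<in> sets P" and B: "B \<in> sets (history_space t)"
        using C_in by blast
      \<comment> \<open>On a rectangle the inner integral factors, which produces the expression in
        the defining equation of \<open>is_belief\<close>.\<close>
      have eq: "(\<integral>\<^sup>+m'. indicator C (m', h) \<partial>b h) = emeasure (b h) A * indicator B h"
        if "h \<in> histories t" for h
        using A sets_belief[OF t that] by (simp add: C indicator_times nn_integral_multc)
      have "?J (\<lambda>x. \<integral>\<^sup>+y. indicator C y \<partial>K x)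
          = (\<integral>\<^sup>+m. \<integral>\<^sup>+h. (\<integral>\<^sup>+m'. indicator C (m', h) \<partial>b h) \<partial>history_pmf \<sigma> (r m) \<pi> t \<partial>P)"
        by (rule J_K) (use A B in \<open>simp add: C\<close>)
      also have "\<dots> = (\<integral>\<^sup>+m. \<integral>\<^sup>+h. emeasure (b h) A * indicator B h \<partial>history_pmf \<sigma> (r m) \<pi> t \<partial>P)"
        by (intro history_integral_cong eq)
      also have "\<dots> = ?J (indicator C)"
        using belief \<pi> t A B by (simp add: is_belief_def C indicator_times)
      finally show ?thesis by (rule sym)
    qed
    show "?J (indicator (space ?M)) = ?J (\<lambda>x. \<integral>\<^sup>+y. indicator (space ?M) y \<partial>K x)"
      by (rule rect) (use sets.top in \<open>auto simp only: space_pair_measure\<close>)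
    have "?J (\<lambda>x. \<integral>\<^sup>+y. indicator (space ?M) y \<partial>K x) = ?J (indicator (space ?M))"
      by (rule rect[symmetric]) (use sets.top in \<open>auto simp only: space_pair_measure\<close>)
    \<comment> \<open>Finiteness: both integrating laws are probability measures, so the total mass
      is at most 1.\<close>
    also have "\<dots> \<le> (\<integral>\<^sup>+m. \<integral>\<^sup>+h. 1 \<partial>history_pmf \<sigma> (r m) \<pi> t \<partial>P)"
      by (intro nn_integral_mono) (simp split: split_indicator)
    also have "\<dots> = 1"
      by (simp add: measure_pmf.emeasure_space_1[simplified] emeasure_space_1)
    finally show "?J (\<lambda>x. \<integral>\<^sup>+y. indicator (space ?M) y \<partial>K x) < \<infinity>"
      by (rule order.strict_trans1) simp
  qed
  then show ?thesis using J_K[OF f] by simp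
qed

subsection \<open>Reconstruction of the history from state and belief\<close>

lemma measurable_section:
  assumes t: "t \<le> T" "h \<in> histories t" and f: "f \<in> borel_measurable (P \<Otimes>\<^sub>M history_space t)"
  shows "(\<lambda>m. f (m, h)) \<in> borel_measurable (b h)"
proof -
  have "(\<lambda>m. (m, h)) \<in> b h \<rightarrow>\<^sub>M P \<Otimes>\<^sub>M history_space t"
    using t sets_belief[OF t] by (intro measurable_Pair measurable_const) (simp_all add: measurable_ident_sets)
  from measurable_compose[OF this f] show ?thesis .
qed

text \<open>A candidate inverse of the map from \<open>h\<close> to \<open>(snd h, b h)\<close>.
  Means are used because they depend measurably on \<open>\<beta>\<close>, and the mean of an almost
  surely constant reward is that constant.\<close>

definition belief_history :: "('p, 'a) state \<Rightarrow> 'm measure \<Rightarrow> ('p, 'a) history" where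
  "belief_history s \<beta> = history_of s (\<lambda>i. \<integral>m. r m (prefix_state s i) (snd s ! i) \<partial>\<beta>)"

lemma measurable_belief_history:
  assumes s: "s \<in> states T"
  shows "belief_history s \<in> prob_algebra P \<rightarrow>\<^sub>M history_space (length (snd s))"
proof (rule measurable_history_spaceI)
  show "belief_history s \<beta> \<in> histories (length (snd s))" for \<beta>
    by (simp add: belief_history_def history_of_in_histories)
  show "(\<lambda>\<beta>. snd (belief_history s \<beta>)) \<in> prob_algebra P \<rightarrow>\<^sub>M count_space UNIV"
    by (simp add: belief_history_def)
  fix i assume i: "i < length (snd s)"
  have "prefix_state s i \<in> states T"
    using s by (auto simp: states_def prefix_state_def)
  then have "(\<lambda>\<beta>. \<integral>m. r m (prefix_state s i) (snd s ! i) \<partial>\<beta>) \<in> borel_measurable (prob_algebra P)"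
    unfolding prob_algebra_def
    by (intro measurable_restrict_space1 integral_measurable_subprob_algebra measurable_reward_fixed)
  then show "(\<lambda>\<beta>. fst (belief_history s \<beta>) ! i) \<in>
      prob_algebra P \<rightarrow>\<^sub>M count_space UNIV \<Otimes>\<^sub>M (count_space UNIV \<Otimes>\<^sub>M borel)"
    using i by (simp add: belief_history_def history_of_def)
qed

lemma belief_history_eq:
  assumes \<pi>: "is_policy T \<pi>" and t: "t \<le> T"
  shows "AE m in P. \<forall>h\<in>set_pmf (history_pmf \<sigma> (r m) \<pi> t). belief_history (snd h) (b h) = h"
proof -
  let ?M = "P \<Otimes>\<^sub>M history_space t"
  define err where "err m h i = (r m (prefix_state (snd h) i) (snd (snd h) ! i) \<noteq> reward_at h i)"
    for m and h :: "('p, 'a) history" and i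
  \<comment> \<open>\<open>f\<close> flags a pair in which some observed reward differs from the one
    that the MDP prescribes.\<close>
  define f :: "'m \<times> ('p, 'a) history \<Rightarrow> ennreal"
    where "f x = (if \<exists>i\<in>{..<t}. err (fst x) (snd x) i then 1 else 0)" for x
  have err: "Measurable.pred ?M (\<lambda>x. err (fst x) (snd x) i)" if i: "i < t" for i
  proof -
    have state: "(\<lambda>x. snd (snd x)) \<in> ?M \<rightarrow>\<^sub>M count_space UNIV"
      by (rule measurable_compose[OF measurable_snd measurable_history_state])
    have "(\<lambda>x. r (fst x) (prefix_state (snd (snd x)) i) (snd (snd (snd x)) ! i)) \<in> borel_measurable ?M"
    proof (rule measurable_reward)
      show "prefix_state (snd (snd x)) i \<in> states T" if "x \<in> space ?M" for x
        using that t i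
        by (auto simp: space_pair_measure states_def prefix_state_def dest: length_snd_histories)
    qed (auto intro: measurable_fst measurable_compose[OF state])
    moreover have "(\<lambda>x. reward_at (snd x) i) \<in> borel_measurable ?M"
      by (rule measurable_compose[OF measurable_snd measurable_reward_at[OF i]])
    ultimately show ?thesis unfolding err_def by measurable
  qed
  have f: "f \<in> borel_measurable ?M"
    unfolding f_def
    by (intro measurable_If measurable_const pred_intros_finite) (use err in auto)
  have "(\<integral>\<^sup>+m. \<integral>\<^sup>+h. f (m, h) \<partial>history_pmf \<sigma> (r m) \<pi> t \<partial>P)
      \<le> (\<integral>\<^sup>+m. \<integral>\<^sup>+h. 0 \<partial>history_pmf \<sigma> (r m) \<pi> t \<partial>P)"
    by (rule history_integral_mono) (auto simp: f_def err_def rewards_history_pmf)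
  \<comment> \<open>The true MDP never mismatches the rewards on the support; by
    \<open>belief_integral\<close> the expected mismatch of an MDP drawn from the belief vanishes as
    well.\<close>
  then have "(\<integral>\<^sup>+m. \<integral>\<^sup>+h. (\<integral>\<^sup>+m'. f (m', h) \<partial>b h) \<partial>history_pmf \<sigma> (r m) \<pi> t \<partial>P) = 0"
    by (simp add: belief_integral[OF \<pi> t f])
  moreover have "(\<lambda>x. \<integral>\<^sup>+m'. f (m', snd x) \<partial>b (snd x)) \<in> borel_measurable ?M"
    by (rule measurable_compose[OF measurable_snd measurable_belief_integral[OF t f]])
  from measurable_history_integral[OF \<pi> t this]
  have "(\<lambda>m. \<integral>\<^sup>+h. (\<integral>\<^sup>+m'. f (m', h) \<partial>b h) \<partial>history_pmf \<sigma> (r m) \<pi> t) \<in> borel_measurable P"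
    by simp
  ultimately have "AE m in P. (\<integral>\<^sup>+h. (\<integral>\<^sup>+m'. f (m', h) \<partial>b h) \<partial>history_pmf \<sigma> (r m) \<pi> t) = 0"
    by (simp add: nn_integral_0_iff_AE)
  then show ?thesis
  proof (rule AE_mp, intro AE_I2 impI ballI)
    fix m h
    assume "(\<integral>\<^sup>+h. (\<integral>\<^sup>+m'. f (m', h) \<partial>b h) \<partial>history_pmf \<sigma> (r m) \<pi> t) = 0"
      and h: "h \<in> set_pmf (history_pmf \<sigma> (r m) \<pi> t)"
    then have "(\<integral>\<^sup>+m'. f (m', h) \<partial>b h) = 0"
      by (simp add: nn_integral_0_iff_AE AE_measure_pmf_iff)
    moreover have ht: "h \<in> histories t" by (rule subsetD[OF set_history_pmf h])
    note sec = measurable_section[OF t ht f]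
    ultimately have AE: "AE m' in b h. f (m', h) = 0"
      by (simp add: nn_integral_0_iff_AE)
    interpret b: prob_space "b h" by (rule prob_space_belief[OF t ht])
    have len: "length (snd (snd h)) = t" by (rule length_snd_histories[OF ht])
    \<comment> \<open>Under the belief the reward is almost surely constant and equal to the
      observed one, hence so is its mean.\<close>
    have "(\<integral>m'. r m' (prefix_state (snd h) i) (snd (snd h) ! i) \<partial>b h) = reward_at h i"
      if i: "i < t" for i
    proof -
      have "prefix_state (snd h) i \<in> states T"
        using len t by (simp add: states_def prefix_state_def)
      then have "(\<lambda>m'. r m' (prefix_state (snd h) i) (snd (snd h) ! i)) \<in> borel_measurable (b h)"
        by (simp add: measurable_cong_sets[OF sets_belief[OF t ht] refl] measurable_reward_fixed)
      moreover have "AE m' in b h. r m' (prefix_state (snd h) i) (snd (snd h) ! i) = reward_at h i"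
        using AE by (rule AE_mp) (use i in \<open>auto simp: f_def err_def split: if_splits\<close>)
      ultimately have "(\<integral>m'. r m' (prefix_state (snd h) i) (snd (snd h) ! i) \<partial>b h)
          = (\<integral>m'. reward_at h i \<partial>b h)"
        by (intro integral_cong_AE) simp_all
      then show ?thesis by (simp add: b.prob_space)
    qed
    then have "belief_history (snd h) (b h) = history_of (snd h) (reward_at h)"
      unfolding belief_history_def by (intro history_of_cong) (simp add: len)
    then show "belief_history (snd h) (b h) = h"
      by (simp add: history_of_rewards[OF ht])
  qed
qed

subsection \<open>Dynamic programming\<close>

text \<open>The Bellman recursion, indexed by the number of remaining steps, with the belief at
  \<open>h\<close> as law of the MDP. The payoff \<open>g\<close> is collected only at the end and
  no stage rewards are added, because a complete history records all rewards.\<close>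

primrec opt_value :: "(('p, 'a) history \<Rightarrow> ennreal) \<Rightarrow> nat \<Rightarrow> ('p, 'a) history \<Rightarrow> ennreal" where
  "opt_value g 0 = g"
| "opt_value g (Suc k) =
     (\<lambda>h. SUP a. \<integral>\<^sup>+m. opt_value g k (extend_history h a (r m (snd h) a)) \<partial>b h)"

definition action_value ::
  "(('p, 'a) history \<Rightarrow> ennreal) \<Rightarrow> nat \<Rightarrow> ('p, 'a) history \<Rightarrow> 'a \<Rightarrow> ennreal" where
  "action_value g k h a = (\<integral>\<^sup>+m. opt_value g k (extend_history h a (r m (snd h) a)) \<partial>b h)"

text \<open>Choosing from the set of maximizers makes \<open>greedy\<close> depend on
  \<open>h\<close> only through that set, which is one of finitely many. Its measurability rests on
  this.\<close>

definition greedy :: "(('p, 'a) history \<Rightarrow> ennreal) \<Rightarrow> nat \<Rightarrow> ('p, 'a) history \<Rightarrow> 'a" where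
  "greedy g k h = (SOME a. a \<in> {a. \<forall>a'. action_value g k h a' \<le> action_value g k h a})"

lemma opt_value_Suc: "opt_value g (Suc k) h = (SUP a. action_value g k h a)"
  by (simp add: action_value_def)

text \<open>There are finitely many actions, so the supremum is attained.\<close>

lemma action_value_greedy: "action_value g k h (greedy g k h) = opt_value g (Suc k) h"
proof -
  let ?Q = "action_value g k h"
  have "Max (range ?Q) \<in> range ?Q" by (rule Max_in) auto
  then obtain a where "?Q a = Max (range ?Q)" by (metis imageE)
  then have "\<forall>a'. ?Q a' \<le> ?Q a" by simp
  then have "\<exists>a. a \<in> {a. \<forall>a'. ?Q a' \<le> ?Q a}" by blast
  then have "greedy g k h \<in> {a. \<forall>a'. ?Q a' \<le> ?Q a}"
    unfolding greedy_def by (rule someI_ex)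
  then show ?thesis
    unfolding opt_value_Suc by (intro antisym SUP_upper SUP_least) auto
qed

lemma measurable_next_value:
  assumes "t < T" "opt_value g k \<in> borel_measurable (history_space (Suc t))"
  shows "(\<lambda>x. opt_value g k (extend_history (snd x) a (r (fst x) (snd (snd x)) a)))
    \<in> borel_measurable (P \<Otimes>\<^sub>M history_space t)"
  by (rule measurable_compose[OF _ assms(2)])
    (intro measurable_next_history assms(1) measurable_fst measurable_snd)

lemma measurable_action_value:
  assumes "t < T" "opt_value g k \<in> borel_measurable (history_space (Suc t))"
  shows "(\<lambda>h. action_value g k h a) \<in> borel_measurable (history_space t)"
  using measurable_belief_integral[OF _ measurable_next_value[OF assms]] assms(1)
  by (simp add: action_value_def)

text \<open>With \<open>k\<close> steps left the history has length \<open>T - k\<close>. Belief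
  integrals and finite suprema preserve measurability, so it propagates backwards.\<close>

lemma measurable_opt_value:
  assumes "g \<in> borel_measurable (history_space T)" "k \<le> T"
  shows "opt_value g k \<in> borel_measurable (history_space (T - k))"
  using assms(2)
proof (induction k)
  case 0
  then show ?case using assms by simp
next
  case (Suc k)
  then have "opt_value g k \<in> borel_measurable (history_space (Suc (T - Suc k)))"
    by (simp add: Suc_diff_Suc)
  from measurable_action_value[OF _ this] Suc.prems show ?case
    unfolding opt_value_Suc by (intro borel_measurable_SUP) auto
qed

lemma measurable_opt_value_Suc:
  assumes "g \<in> borel_measurable (history_space T)" "t < T"
  shows "opt_value g (T - Suc t) \<in> borel_measurable (history_space (Suc t))"
  using measurable_opt_value[of g "T - Suc t"] assms by simp

lemma measurable_greedy:
  assumes g: "g \<in> borel_measurable (history_space T)" and t: "t < T"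
  shows "greedy g (T - Suc t) \<in> history_space t \<rightarrow>\<^sub>M count_space UNIV"
proof -
  let ?Q = "action_value g (T - Suc t)"
  have Q[measurable]: "(\<lambda>h. ?Q h a) \<in> borel_measurable (history_space t)" for a
    by (rule measurable_action_value[OF t measurable_opt_value_Suc[OF g t]])
  have "(\<lambda>h. {a. \<forall>a'. ?Q h a' \<le> ?Q h a}) \<in> history_space t \<rightarrow>\<^sub>M count_space UNIV"
  proof (subst measurable_count_space_eq2, simp, safe)
    fix A :: "'a set"
    \<comment> \<open>The event that \<open>A\<close> is the set of maximizers is a finite Boolean
      combination of comparisons between action values.\<close>
    have "Measurable.pred (history_space t) (\<lambda>h. \<forall>a. a \<in> A \<longleftrightarrow> (\<forall>a'. ?Q h a' \<le> ?Q h a))"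
      by measurable
    then have "{h \<in> space (history_space t). \<forall>a. a \<in> A \<longleftrightarrow> (\<forall>a'. ?Q h a' \<le> ?Q h a)} \<in> sets (history_space t)"
      by (rule predE)
    also have "{h \<in> space (history_space t). \<forall>a. a \<in> A \<longleftrightarrow> (\<forall>a'. ?Q h a' \<le> ?Q h a)} =
        (\<lambda>h. {a. \<forall>a'. ?Q h a' \<le> ?Q h a}) -` {A} \<inter> space (history_space t)"
      by (simp only: set_eq_iff vimage_def) blast
    finally show "(\<lambda>h. {a. \<forall>a'. ?Q h a' \<le> ?Q h a}) -` {A} \<inter> space (history_space t)
        \<in> sets (history_space t)" .
  qed simp
  then show ?thesis
    unfolding greedy_def by (rule measurable_compose) simp
qed

text \<open>The one-step Bellman identity for an arbitrary policy. The reward appended at step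
  \<open>t\<close> depends on the true MDP; averaging over the belief turns the next value into
  \<open>action_value\<close>.\<close>

lemma opt_value_step:
  assumes \<pi>: "is_policy T \<pi>" and t: "t < T" and g: "g \<in> borel_measurable (history_space T)"
  shows "(\<integral>\<^sup>+m. \<integral>\<^sup>+h. opt_value g (T - Suc t) h \<partial>history_pmf \<sigma> (r m) \<pi> (Suc t) \<partial>P) =
    (\<integral>\<^sup>+m. \<integral>\<^sup>+h. (\<integral>\<^sup>+a. action_value g (T - Suc t) h a \<partial>\<pi> h) \<partial>history_pmf \<sigma> (r m) \<pi> t \<partial>P)"
proof -
  define V where "V = opt_value g (T - Suc t)"
  define q where "q a x = V (extend_history (snd x) a (r (fst x) (snd (snd x)) a))"
    for a and x :: "'m \<times> ('p, 'a) history"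
  have t': "t \<le> T" using t by simp
  have q: "q a \<in> borel_measurable (P \<Otimes>\<^sub>M history_space t)" for a
    unfolding q_def V_def by (rule measurable_next_value[OF t measurable_opt_value_Suc[OF g t]])
  have "(\<lambda>x. pmf (\<pi> (snd x)) a) \<in> borel_measurable (P \<Otimes>\<^sub>M history_space t)" for a
    by (rule measurable_compose[OF measurable_snd measurable_pmf_policy[OF \<pi> t]])
  with q have f: "(\<lambda>x. \<Sum>a\<in>UNIV. q a x * ennreal (pmf (\<pi> (snd x)) a))
      \<in> borel_measurable (P \<Otimes>\<^sub>M history_space t)"
    by measurable
  have "(\<integral>\<^sup>+m. \<integral>\<^sup>+h. V h \<partial>history_pmf \<sigma> (r m) \<pi> (Suc t) \<partial>P) =
      (\<integral>\<^sup>+m. \<integral>\<^sup>+h. (\<Sum>a\<in>UNIV. q a (m, h) * ennreal (pmf (\<pi> h) a)) \<partial>history_pmf \<sigma> (r m) \<pi> t \<partial>P)"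
    by (simp add: q_def nn_integral_pmf_finite_type)
  also have "\<dots> = (\<integral>\<^sup>+m. \<integral>\<^sup>+h. (\<integral>\<^sup>+m'. (\<Sum>a\<in>UNIV. q a (m', h) * ennreal (pmf (\<pi> h) a)) \<partial>b h)
      \<partial>history_pmf \<sigma> (r m) \<pi> t \<partial>P)"
    using belief_integral[OF \<pi> t' f] by simp
  also have "\<dots> = (\<integral>\<^sup>+m. \<integral>\<^sup>+h. (\<integral>\<^sup>+a. action_value g (T - Suc t) h a \<partial>\<pi> h)
      \<partial>history_pmf \<sigma> (r m) \<pi> t \<partial>P)"
  proof (rule history_integral_cong)
    fix m and h :: "('p, 'a) history" assume h: "h \<in> histories t"
    note sec[measurable] = measurable_section[OF t' h q]
    \<comment> \<open>The action probabilities depend on \<open>h\<close> alone, so they come out of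
      the integral over the belief.\<close>
    have "(\<integral>\<^sup>+m'. (\<Sum>a\<in>UNIV. q a (m', h) * ennreal (pmf (\<pi> h) a)) \<partial>b h) =
        (\<Sum>a\<in>UNIV. (\<integral>\<^sup>+m'. q a (m', h) \<partial>b h) * ennreal (pmf (\<pi> h) a))"
      by (simp add: nn_integral_sum nn_integral_multc)
    then show "(\<integral>\<^sup>+m'. (\<Sum>a\<in>UNIV. q a (m', h) * ennreal (pmf (\<pi> h) a)) \<partial>b h) =
        (\<integral>\<^sup>+a. action_value g (T - Suc t) h a \<partial>\<pi> h)"
      by (simp add: nn_integral_pmf_finite_type action_value_def q_def V_def)
  qed
  finally show ?thesis by (simp add: V_def)
qed

text \<open>A policy averages action values, and an average is at most the supremum. This is the
  supermartingale half of the dynamic programming argument.\<close>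

lemma opt_value_decreasing:
  assumes \<pi>: "is_policy T \<pi>" and t: "t < T" and g: "g \<in> borel_measurable (history_space T)"
  shows "(\<integral>\<^sup>+m. \<integral>\<^sup>+h. opt_value g (T - Suc t) h \<partial>history_pmf \<sigma> (r m) \<pi> (Suc t) \<partial>P)
    \<le> (\<integral>\<^sup>+m. \<integral>\<^sup>+h. opt_value g (T - t) h \<partial>history_pmf \<sigma> (r m) \<pi> t \<partial>P)"
  unfolding opt_value_step[OF assms]
proof (rule history_integral_mono)
  fix h
  have "(\<integral>\<^sup>+a. action_value g (T - Suc t) h a \<partial>\<pi> h) \<le> (\<integral>\<^sup>+a. opt_value g (Suc (T - Suc t)) h \<partial>\<pi> h)"
    unfolding opt_value_Suc by (intro nn_integral_mono SUP_upper) simp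
  also have "\<dots> = opt_value g (T - t) h"
    unfolding Suc_diff_Suc[OF t] by (simp add: measure_pmf.emeasure_space_1[simplified])
  finally show "(\<integral>\<^sup>+a. action_value g (T - Suc t) h a \<partial>\<pi> h) \<le> opt_value g (T - t) h" .
qed

text \<open>The time is read off as the length of the action list, and the greedy action is taken at
  the history reconstructed from state and belief. At states of length \<open>T\<close> or more no
  decision is due, and a constant value keeps the rule measurable.\<close>

definition greedy_rule :: "(('p, 'a) history \<Rightarrow> ennreal) \<Rightarrow> ('p, 'a) state \<times> 'm measure \<Rightarrow> 'a pmf" where
  "greedy_rule g x = return_pmf (if length (snd (fst x)) < T
     then greedy g (T - Suc (length (snd (fst x)))) (belief_history (fst x) (snd x)) else undefined)"

abbreviation adaptive_policy :: "(('p, 'a) history \<Rightarrow> ennreal) \<Rightarrow> ('p, 'a) history \<Rightarrow> 'a pmf" where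
  "adaptive_policy g h \<equiv> greedy_rule g (snd h, b h)"

lemma measurable_return_pmf:
  "(\<lambda>a. measure_pmf (return_pmf a)) \<in> count_space UNIV \<rightarrow>\<^sub>M prob_algebra (count_space UNIV)"
  by (auto simp: space_prob_algebra intro: prob_space_measure_pmf)

text \<open>States are countable, so measurability in the belief for each fixed state suffices. The
  set \<open>A\<close> is left open to serve both \<open>states T\<close> and the states of one
  given length.\<close>

lemma measurable_greedy_rule:
  assumes g: "g \<in> borel_measurable (history_space T)"
  shows "(\<lambda>x. measure_pmf (greedy_rule g x))
    \<in> count_space A \<Otimes>\<^sub>M prob_algebra P \<rightarrow>\<^sub>M prob_algebra (count_space UNIV)"
proof (rule measurable_pair_measure_countable1)
  fix s :: "('p, 'a) state"
  show "(\<lambda>\<beta>. measure_pmf (greedy_rule g (s, \<beta>))) \<in> prob_algebra P \<rightarrow>\<^sub>M prob_algebra (count_space UNIV)"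
  proof (cases "length (snd s) < T")
    case True
    then have "s \<in> states T" by (simp add: states_def)
    from measurable_compose[OF measurable_compose[OF measurable_belief_history[OF this]
          measurable_greedy[OF g True]] measurable_return_pmf]
    show ?thesis using True by (simp only: greedy_rule_def fst_conv snd_conv if_True)
  next
    case False
    then show ?thesis
      unfolding greedy_rule_def fst_conv snd_conv if_not_P[OF False]
      by (intro measurable_const) (simp add: space_prob_algebra prob_space_measure_pmf)
  qed
qed simp

lemma is_policy_adaptive:
  assumes g: "g \<in> borel_measurable (history_space T)"
  shows "is_policy T (adaptive_policy g)"
  unfolding is_policy_def
proof (intro allI impI)
  fix t assume t: "t < T"
  let ?A = "{s. length (snd s) = t} :: ('p, 'a) state set"
  have "snd \<in> history_space t \<rightarrow>\<^sub>M count_space ?A"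
  proof (rule measurableI)
    show "snd h \<in> space (count_space ?A)" if "h \<in> space (history_space t)" for h
      using that by (simp add: length_snd_histories)
    show "snd -` X \<inter> space (history_space t) \<in> sets (history_space t)" for X
      by (rule measurable_sets[OF measurable_history_state]) simp
  qed
  then have "(\<lambda>h. (snd h, b h)) \<in> history_space t \<rightarrow>\<^sub>M count_space ?A \<Otimes>\<^sub>M prob_algebra P"
    by (rule measurable_Pair) (rule measurable_belief, use t in simp)
  then show "(\<lambda>h. measure_pmf (adaptive_policy g h)) \<in> history_space t \<rightarrow>\<^sub>M prob_algebra (count_space UNIV)"
    by (rule measurable_compose[OF _ measurable_greedy_rule[OF g]])
qed

text \<open>Almost surely the reconstructed history is the actual one, so the action taken attains
  the supremum. The belief is a version for all policies at once, so
  \<open>belief_history_eq\<close> applies to this policy although it is itself built from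
  \<open>b\<close>.\<close>

lemma opt_value_adaptive:
  assumes t: "t < T" and g: "g \<in> borel_measurable (history_space T)"
  defines "\<pi> \<equiv> adaptive_policy g"
  shows "(\<integral>\<^sup>+m. \<integral>\<^sup>+h. opt_value g (T - Suc t) h \<partial>history_pmf \<sigma> (r m) \<pi> (Suc t) \<partial>P)
    = (\<integral>\<^sup>+m. \<integral>\<^sup>+h. opt_value g (T - t) h \<partial>history_pmf \<sigma> (r m) \<pi> t \<partial>P)"
proof -
  have \<pi>: "is_policy T \<pi>" unfolding \<pi>_def by (rule is_policy_adaptive[OF g])
  have t': "t \<le> T" using t by simp
  show ?thesis
    unfolding opt_value_step[OF \<pi> t g]
  proof (rule nn_integral_cong_AE, rule AE_mp[OF belief_history_eq[OF \<pi> t']],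
      rule AE_I2, rule impI, rule nn_integral_cong_AE, rule AE_pmfI)
    fix m h
    assume eq: "\<forall>h\<in>set_pmf (history_pmf \<sigma> (r m) \<pi> t). belief_history (snd h) (b h) = h"
      and h: "h \<in> set_pmf (history_pmf \<sigma> (r m) \<pi> t)"
    have "length (snd (snd h)) = t"
      by (rule length_snd_histories[OF subsetD[OF set_history_pmf h]])
    with bspec[OF eq h] have "\<pi> h = return_pmf (greedy g (T - Suc t) h)"
      by (simp add: \<pi>_def greedy_rule_def t)
    then show "(\<integral>\<^sup>+a. action_value g (T - Suc t) h a \<partial>\<pi> h) = opt_value g (T - t) h"
      using action_value_greedy[of g "T - Suc t" h] by (simp only: Suc_diff_Suc[OF t]) simp
  qed
qed

text \<open>Chaining the steps from \<open>T\<close> back to \<open>0\<close>: for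
  \<open>\<pi>\<close> the expected optimal value at time \<open>T\<close>, which is that of
  \<open>g\<close>, is at most the one at time \<open>0\<close>; for the adaptive policy the two are
  equal.\<close>

lemma adaptive_policy_optimal:
  assumes g: "g \<in> borel_measurable (history_space T)" and \<pi>: "is_policy T \<pi>"
  shows "(\<integral>\<^sup>+m. \<integral>\<^sup>+h. g h \<partial>history_pmf \<sigma> (r m) \<pi> T \<partial>P)
    \<le> (\<integral>\<^sup>+m. \<integral>\<^sup>+h. g h \<partial>history_pmf \<sigma> (r m) (adaptive_policy g) T \<partial>P)"
proof -
  let ?E = "\<lambda>\<pi> t. \<integral>\<^sup>+m. \<integral>\<^sup>+h. opt_value g (T - t) h \<partial>history_pmf \<sigma> (r m) \<pi> t \<partial>P"
  have upper: "t \<le> T \<Longrightarrow> ?E \<pi> t \<le> ?E \<pi> 0" for t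
  proof (induction t)
    case (Suc t)
    then have "?E \<pi> (Suc t) \<le> ?E \<pi> t" by (intro opt_value_decreasing[OF \<pi> _ g]) simp
    also have "\<dots> \<le> ?E \<pi> 0" using Suc by simp
    finally show ?case .
  qed simp
  have attained: "t \<le> T \<Longrightarrow> ?E (adaptive_policy g) t = ?E (adaptive_policy g) 0" for t
  proof (induction t)
    case (Suc t)
    then have "?E (adaptive_policy g) (Suc t) = ?E (adaptive_policy g) t"
      by (intro opt_value_adaptive[OF _ g]) simp
    also have "\<dots> = ?E (adaptive_policy g) 0" using Suc by simp
    finally show ?case .
  qed simp
  \<comment> \<open>The law of the initial history involves no policy.\<close>
  have "?E \<pi> 0 = ?E (adaptive_policy g) 0" by simp
  with upper[of T] attained[of T] show ?thesis by simp
qed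

subsection \<open>The Bayesian objective\<close>

text \<open>The shift makes the return nonnegative when rewards are bounded by \<open>C\<close>, so that the
  dynamic program can be run in \<^typ>\<open>ennreal\<close>, free of integrability conditions.\<close>

definition shifted_return :: "real \<Rightarrow> ('p, 'a) history \<Rightarrow> ennreal" where
  "shifted_return C h = ennreal (real T * C + (\<Sum>t<T. reward_at h t))"

lemma measurable_shifted_return: "shifted_return C \<in> borel_measurable (history_space T)"
proof -
  have "(\<lambda>h. \<Sum>t<T. reward_at h t) \<in> borel_measurable (history_space T)"
    by (intro borel_measurable_sum measurable_reward_at) simp
  then show ?thesis unfolding shifted_return_def by measurable
qed

context
  fixes C :: real
  assumes bound: "\<And>m s a. m \<in> space P \<Longrightarrow> s \<in> states T \<Longrightarrow> \<bar>r m s a\<bar> \<le> C"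
begin

lemma abs_reward_sum_le:
  assumes m: "m \<in> space P" and h: "h \<in> set_pmf (history_pmf \<sigma> (r m) \<pi> T)"
  shows "\<bar>\<Sum>t<T. reward_at h t\<bar> \<le> real T * C"
proof -
  have "\<bar>reward_at h t\<bar> \<le> C" if "t < T" for t
    using that length_snd_histories[OF subsetD[OF set_history_pmf h]]
    by (simp add: rewards_history_pmf[OF h that] states_def prefix_state_def bound[OF m])
  then have "(\<Sum>t<T. \<bar>reward_at h t\<bar>) \<le> (\<Sum>t<T. C)"
    by (intro sum_mono) simp
  then show ?thesis
    by (intro order_trans[OF sum_abs]) simp
qed

text \<open>On the support the recorded rewards sum to at least \<open>- (real T * C)\<close>, so
  \<open>ennreal\<close> truncates nothing and the nonnegative integral is the shifted real
  expectation.\<close>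

lemma
  assumes m: "m \<in> space P"
  shows nn_integral_shifted_return:
      "(\<integral>\<^sup>+h. shifted_return C h \<partial>history_pmf \<sigma> (r m) \<pi> T) = ennreal (real T * C + return_in T \<sigma> (r m) \<pi>)"
    and abs_return_in_le: "\<bar>return_in T \<sigma> (r m) \<pi>\<bar> \<le> real T * C"
proof -
  let ?p = "history_pmf \<sigma> (r m) \<pi> T"
  let ?S = "\<lambda>h. \<Sum>t<T. reward_at h t"
  have bd: "AE h in ?p. \<bar>?S h\<bar> \<le> real T * C"
    by (rule AE_pmfI, rule abs_reward_sum_le[OF m])
  have int: "integrable ?p ?S"
    by (rule measure_pmf.integrable_const_bound[where B="real T * C"]) (use bd in simp_all)
  \<comment> \<open>\<open>return_in\<close> evaluates rewards at the recorded states and actions;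
    on the support these are the recorded rewards.\<close>
  have ret: "return_in T \<sigma> (r m) \<pi> = (\<integral>h. ?S h \<partial>?p)"
    unfolding return_in_def
    by (intro integral_cong_AE AE_pmfI sum.cong) (simp_all add: rewards_history_pmf)
  have "(\<integral>\<^sup>+h. shifted_return C h \<partial>?p) = ennreal (\<integral>h. real T * C + ?S h \<partial>?p)"
    unfolding shifted_return_def
    by (intro nn_integral_eq_integral) (use int bd in \<open>auto simp: abs_le_iff\<close>)
  then show "(\<integral>\<^sup>+h. shifted_return C h \<partial>?p) = ennreal (real T * C + return_in T \<sigma> (r m) \<pi>)"
    by (simp add: ret int)
  have "\<bar>\<integral>h. ?S h \<partial>?p\<bar> \<le> (\<integral>h. \<bar>?S h\<bar> \<partial>?p)" by (rule integral_abs_bound)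
  also have "\<dots> \<le> (\<integral>h. real T * C \<partial>?p)"
    by (intro integral_mono_AE) (use int bd in simp_all)
  finally show "\<bar>return_in T \<sigma> (r m) \<pi>\<bar> \<le> real T * C" by (simp add: ret)
qed

text \<open>The second conclusion lets an inequality between \<open>ennreal\<close> images be read
  back as one between real objectives.\<close>

lemma bayes_objective_shifted:
  assumes \<pi>: "is_policy T \<pi>"
  shows "(\<integral>\<^sup>+m. \<integral>\<^sup>+h. shifted_return C h \<partial>history_pmf \<sigma> (r m) \<pi> T \<partial>P)
      = ennreal (real T * C + bayes_objective T \<sigma> r P \<pi>)"
    and "0 \<le> real T * C + bayes_objective T \<sigma> r P \<pi>"
proof -
  let ?R = "\<lambda>m. return_in T \<sigma> (r m) \<pi>"
  have nonneg: "0 \<le> real T * C + ?R m" if "m \<in> space P" for m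
    using abs_return_in_le[OF that, of \<pi>] by (simp add: abs_le_iff)
  \<comment> \<open>Measurability of the return in \<open>m\<close> comes from writing it as
    \<open>enn2real\<close> of the shifted nonnegative integral, minus the shift.\<close>
  have "(\<lambda>x. shifted_return C (snd x)) \<in> borel_measurable (P \<Otimes>\<^sub>M history_space T)"
    by (rule measurable_compose[OF measurable_snd measurable_shifted_return])
  from measurable_history_integral[OF \<pi> order_refl this]
  have "(\<lambda>m. enn2real (\<integral>\<^sup>+h. shifted_return C h \<partial>history_pmf \<sigma> (r m) \<pi> T) - real T * C) \<in> borel_measurable P"
    by simp
  then have meas: "?R \<in> borel_measurable P"
    by (rule measurable_cong[THEN iffD1, rotated]) (simp add: nn_integral_shifted_return nonneg)
  have int: "integrable P ?R"
    by (rule integrable_const_bound[where B="real T * C"]) (use abs_return_in_le meas in simp_all)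
  have "(\<integral>\<^sup>+m. \<integral>\<^sup>+h. shifted_return C h \<partial>history_pmf \<sigma> (r m) \<pi> T \<partial>P) = (\<integral>\<^sup>+m. ennreal (real T * C + ?R m) \<partial>P)"
    by (intro nn_integral_cong nn_integral_shifted_return)
  also have "\<dots> = ennreal (\<integral>m. real T * C + ?R m \<partial>P)"
    by (intro nn_integral_eq_integral) (use int nonneg in auto)
  also have "(\<integral>m. real T * C + ?R m \<partial>P) = real T * C + bayes_objective T \<sigma> r P \<pi>"
    by (simp add: bayes_objective_def int prob_space)
  finally show "(\<integral>\<^sup>+m. \<integral>\<^sup>+h. shifted_return C h \<partial>history_pmf \<sigma> (r m) \<pi> T \<partial>P)
      = ennreal (real T * C + bayes_objective T \<sigma> r P \<pi>)" .
  have "0 \<le> (\<integral>m. real T * C + ?R m \<partial>P)"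
    by (rule Bochner_Integration.integral_nonneg) (rule nonneg)
  then show "0 \<le> real T * C + bayes_objective T \<sigma> r P \<pi>"
    by (simp add: bayes_objective_def int prob_space)
qed

lemma bayes_objective_adaptive:
  assumes "is_policy T \<pi>"
  shows "bayes_objective T \<sigma> r P \<pi> \<le> bayes_objective T \<sigma> r P (adaptive_policy (shifted_return C))"
  using adaptive_policy_optimal[OF measurable_shifted_return assms, of C]
  by (simp add: bayes_objective_shifted assms is_policy_adaptive[OF measurable_shifted_return] ennreal_le_iff)

end

text \<open>\<open>prob_algebra\<close> depends on a measure only through its measurable sets, so a
  rule measurable with respect to the posterior is measurable with respect to the space of
  MDPs.\<close>

lemma uncertainty_adaptive_policy:
  assumes "g \<in> borel_measurable (history_space T)" and "sets M = sets P"
  shows "uncertainty_adaptive T M b (adaptive_policy g)"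
proof -
  have "prob_algebra M = prob_algebra P"
    by (simp add: prob_algebra_def subprob_algebra_cong[OF assms(2)])
  then show ?thesis
    unfolding uncertainty_adaptive_def
    by (intro exI[of _ "greedy_rule g"]) (simp add: measurable_greedy_rule[OF assms(1)])
qed

end

section \<open>The posterior as a probability measure, and the conclusion\<close>

lemma sets_posterior [simp]: "sets (posterior prior lik D) = sets prior"
  by (simp add: posterior_def)

lemma prob_space_posterior:
  assumes [measurable]: "(\<lambda>m. lik m D) \<in> borel_measurable prior"
    and "0 < (\<integral>\<^sup>+ m. ennreal (lik m D) \<partial>prior)" "(\<integral>\<^sup>+ m. ennreal (lik m D) \<partial>prior) < \<infinity>"
  shows "prob_space (posterior prior lik D)"
proof
  have "emeasure (posterior prior lik D) (space (posterior prior lik D))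
      = (\<integral>\<^sup>+m. ennreal (lik m D) / (\<integral>\<^sup>+m'. ennreal (lik m' D) \<partial>prior) \<partial>prior)"
    by (simp add: posterior_def emeasure_density cong: nn_integral_cong)
  also have "\<dots> = 1"
    using assms by (simp add: nn_integral_divide ennreal_divide_self)
  finally show "emeasure (posterior prior lik D) (space (posterior prior lik D)) = 1" .
qed

theorem theorem4p2:
  fixes T :: nat
    and \<sigma> :: "'p :: countable pmf"
    and MM :: "'m measure"
    and r :: "'m \<Rightarrow> ('p, 'a :: finite) state \<Rightarrow> 'a \<Rightarrow> real"
    and prior :: "'m measure"
    and lik :: "'m \<Rightarrow> 'd \<Rightarrow> real"
    and D :: 'd
    and b :: "('p, 'a) history \<Rightarrow> 'm measure"
  assumes "T \<ge> 1"
    and "standard_borel MM"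
    and "\<And>s a. s \<in> states T \<Longrightarrow> (\<lambda>m. r m s a) \<in> borel_measurable MM"
    and "\<exists>C. \<forall>m\<in>space MM. \<forall>s\<in>states T. \<forall>a. \<bar>r m s a\<bar> \<le> C"
    and "prior \<in> space (prob_algebra MM)"
    and "(\<lambda>m. lik m D) \<in> borel_measurable MM"
    and "\<And>m. m \<in> space MM \<Longrightarrow> lik m D \<ge> 0"
    and "0 < (\<integral>\<^sup>+ m. ennreal (lik m D) \<partial>prior)"
    and "(\<integral>\<^sup>+ m. ennreal (lik m D) \<partial>prior) < \<infinity>"
    and "is_belief T \<sigma> r (posterior prior lik D) b"
  shows "\<exists>\<pi>opt. is_policy T \<pi>opt \<and>
           (\<forall>\<pi>. is_policy T \<pi> \<longrightarrow>
              bayes_objective T \<sigma> r (posterior prior lik D) \<pi>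
                \<le> bayes_objective T \<sigma> r (posterior prior lik D) \<pi>opt) \<and>
           uncertainty_adaptive T MM b \<pi>opt"
proof -
  have prior: "sets prior = sets MM"
    using assms(5) by (simp add: space_prob_algebra)
  then have sets: "sets MM = sets (posterior prior lik D)" by simp
  have lik: "(\<lambda>m. lik m D) \<in> borel_measurable prior"
    using assms(6) by (simp add: measurable_cong_sets[OF prior refl])
  interpret P: prob_space "posterior prior lik D"
    by (rule prob_space_posterior[where lik=lik and D=D, OF lik assms(8,9)])
  \<comment> \<open>The posterior has the measurable sets of \<open>MM\<close>, so measurability of
    the rewards transfers to it.\<close>
  interpret bayesian_mdp "posterior prior lik D" T \<sigma> r b
    by unfold_locales (use assms(3,10) in \<open>simp_all add: measurable_cong_sets[OF sets[symmetric] refl]\<close>)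
  obtain C where C: "\<And>m s a. m \<in> space MM \<Longrightarrow> s \<in> states T \<Longrightarrow> \<bar>r m s a\<bar> \<le> C"
    using assms(4) by blast
  \<comment> \<open>The witness is the adaptive policy whose terminal payoff is the return shifted
    by means of the common reward bound \<open>C\<close>.\<close>
  note g = measurable_shifted_return[of C]
  show ?thesis
    using is_policy_adaptive[OF g] bayes_objective_adaptive[OF C] uncertainty_adaptive_policy[OF g sets]
    by (intro exI[of _ "adaptive_policy (shifted_return C)"])
      (simp add: sets_eq_imp_space_eq[OF sets])
qed

end
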